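(* For every $d\ge2$, $\mathbf{MG}_d=\{q^{-d}\}$, that is, $\kappa(\Lambda)=q^{-d}$ for every $\Lambda\in\mathcal L_d$.
   Context: Let $q$ be a prime power, $\mathcal R=\mathbb F_q[x]$, and $\tilde{\mathcal K}=\mathbb F_q((x^{-1}))$, with the absolute value $|\cdot|$ extending $|f|=q^{\deg f}$ for nonzero $f\in\mathcal R$ (and $|0|=0$); $\mathcal O=\mathbb F_q[[x^{-1}]]=\{f\in\tilde{\mathcal K}:|f|\le1\}$. $\mathcal L_d$ is the space of unimodular lattices in $\tilde{\mathcal K}^d$, i.e. sets $g\mathcal R^d$ with $g$ an invertible $d\times d$ matrix over $\tilde{\mathcal K}$ with $|\det(g)|=1$. $\operatorname{Vol}$ is Haar measure on $\tilde{\mathcal K}^d$ normalized by $\operatorname{Vol}(\mathcal O^d)=1$. A box is a set $\mathcal B=B(0,r_1)\times\dots\times B(0,r_d)\subseteq\tilde{\mathcal K}^d$ with all $r_i>0$, where $B(0,r)=\{\alpha\in\tilde{\mathcal K}:|\alpha|\le r\}$; it is admissible for $\Lambda$ if $\mathcal B\cap\Lambda=\{0\}$. The Mordell function is $\kappa(\Lambda)=\sup\{\operatorname{Vol}(\mathcal B):\mathcal B\text{ a box admissible for }\Lambda\}$, and the Gruber–Mordell spectrum is $\mathbf{MG}_d=\{\kappa(\Lambda):\Lambda\in\mathcal L_d\}$. *)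

theory Defs
  imports
    "HOL-Analysis.Analysis"
    "HOL-Computational_Algebra.Formal_Laurent_Series"
begin

text \<open>
  The finite field with \<open>q\<close> elements is a type \<open>'a :: {field, finite}\<close>, with \<open>q = CARD('a)\<close>.
  The field of Laurent series over it in the variable \<open>x\<^sup>-\<^sup>1\<close> is \<open>'a fls\<close>, so that \<open>fls_X\<close>
  stands for \<open>x\<^sup>-\<^sup>1\<close> and \<open>fls_X_inv\<close> stands for \<open>x\<close>.
  The library's distance on \<open>'a fls\<close> uses base 2 instead of base \<open>q\<close>; the topology it
  induces is the one given by the absolute value below.
\<close>

definition fls_abs :: "'a::{field, finite} fls \<Rightarrow> real" where
  "fls_abs f = (if f = 0 then 0 else real CARD('a) powi (- fls_subdegree f))"

definition poly_to_fls :: "'a::field poly \<Rightarrow> 'a fls" where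
  "poly_to_fls p = poly (map_poly fls_const p) fls_X_inv"

definition unimodular_lattices :: "(('a::{field, finite} fls) ^ 'n) set set" where
  "unimodular_lattices =
     {{g *v (\<chi> i. poly_to_fls (p i)) | p. True} | g :: 'a fls ^ 'n ^ 'n.
        invertible g \<and> fls_abs (det g) = 1}"

text \<open>
  Regularity need not be required separately: the definition is used for \<open>'a fls ^ 'n\<close> only,
  where \<open>'a\<close> is finite. This is a second countable locally compact Hausdorff group, on which
  every Borel measure that is finite on compact sets is regular.
\<close>

definition haar_measure :: "'b::{topological_space, ab_group_add} measure \<Rightarrow> bool" where
  "haar_measure M \<longleftrightarrow>
     sets M = sets borel \<and>
     (\<forall>a. \<forall>A\<in>sets borel. emeasure M ((+) a ` A) = emeasure M A) \<and>
     (\<forall>C. compact C \<longrightarrow> emeasure M C < \<infinity>) \<and>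
     (\<forall>U. open U \<longrightarrow> U \<noteq> {} \<longrightarrow> emeasure M U > 0)"

definition vol :: "(('a::{field, finite} fls) ^ 'n) measure" where
  "vol = (THE M. haar_measure M \<and> emeasure M {v. \<forall>i. fls_abs (v $ i) \<le> 1} = 1)"

definition box_set :: "('n \<Rightarrow> real) \<Rightarrow> (('a::{field, finite} fls) ^ 'n) set" where
  "box_set r = {v. \<forall>i. fls_abs (v $ i) \<le> r i}"

definition is_box :: "(('a::{field, finite} fls) ^ 'n) set \<Rightarrow> bool" where
  "is_box B \<longleftrightarrow> (\<exists>r. (\<forall>i. r i > 0) \<and> B = box_set r)"

definition admissible ::
  "(('a::{field, finite} fls) ^ 'n) set \<Rightarrow> ('a fls ^ 'n) set \<Rightarrow> bool" where
  "admissible \<Lambda> B \<longleftrightarrow> B \<inter> \<Lambda> = {0}"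

definition mordell :: "(('a::{field, finite} fls) ^ 'n) set \<Rightarrow> ennreal" where
  "mordell \<Lambda> = Sup {emeasure vol B | B. is_box B \<and> admissible \<Lambda> B}"

definition gruber_mordell_spectrum ::
  "'a::{field, finite} itself \<Rightarrow> 'n::finite itself \<Rightarrow> ennreal set" where
  "gruber_mordell_spectrum _ _ = {mordell \<Lambda> | \<Lambda> :: ('a fls ^ 'n) set. \<Lambda> \<in> unimodular_lattices}"

end

theory Submission
  imports Defs "HOL-Probability.Infinite_Product_Measure"
begin

text \<open>
  The absolute value is discrete, so a box is described by integers: for a cutoff
  \<open>n :: 'n \<Rightarrow> int\<close> it consists of the vectors whose \<open>i\<close>-th coordinate has no coefficient at any
  index below \<open>n i\<close>, the index being the exponent of \<open>x\<^sup>-\<^sup>1\<close>. This box is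
  \<open>coset_box n 0\<close>, and its volume is \<open>q\<close> to the power \<open>- (\<Sum>i. n i)\<close>.

  The idea is to look at an admissible box that is maximal, in the sense that lowering any one
  cutoff by \<open>1\<close> destroys admissibility. The lattice then contains, for each \<open>i\<close>, a vector \<open>v i\<close>
  that lies in the box lowered at \<open>i\<close> but not in the box itself. Its \<open>i\<close>-th coordinate starts
  exactly at \<open>n i - 1\<close>, and its \<open>j\<close>-th coordinate, for the other \<open>j\<close>, not before \<open>n j\<close>. In the
  Leibniz expansion of the determinant of these vectors the product along the diagonal therefore
  strictly dominates all others, and the determinant starts exactly at \<open>\<Sum>i. n i - 1\<close>
  (\<open>det_subdegree_dominant_diagonal\<close>). Moreover the \<open>v i\<close> generate the lattice: expand a lattice
  vector in terms of them and subtract the polynomial parts of the coefficients; what is left is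
  a combination with coefficients of absolute value less than \<open>1\<close>, which lies in the box and in
  the lattice, so it is \<open>0\<close>. Hence the determinant of the \<open>v i\<close> is that of the lattice times a unit
  of the polynomial ring, which has absolute value \<open>1\<close>, and \<open>\<Sum>i. n i = CARD('n)\<close>
  (\<open>maximal_cutoff_sum\<close>). Every maximal box thus has volume \<open>q\<close> to the power \<open>- CARD('n)\<close>.

  Every admissible box lies in a maximal one (\<open>maximal_cutoff_below\<close>). For this it suffices that
  no admissible box stays admissible when stretched without bound in one direction, which follows
  from the pigeonhole principle applied to the vectors \<open>x\<^sup>k\<close> in that direction, reduced modulo the
  lattice (\<open>long_box_not_admissible\<close>). So all admissible boxes have at most the volume of a
  maximal one. Since lattices are discrete, admissible boxes exist, and the supremum is attained.

  The volume is defined by a property that characterises normalised Haar measure, so this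
  measure has to be shown to exist and to be unique. Uniqueness holds because a box is the disjoint
  union of \<open>q\<close> translates of the box with one cutoff raised by \<open>1\<close>; this determines the measure on all
  cosets of boxes, and the cosets of cubes form a countable \<open>\<inter>\<close>-stable generator of the Borel sets.
  For existence, a vector is a choice of finitely many digits at the negative indices of each
  coordinate and of an arbitrary sequence of digits at the others; counting measure on the former
  times the product of uniform measures on the latter is transported to the vectors.
\<close>

no_notation fps_nth (infixl "$" 75)
notation fls_nth (infixl "$$" 75)

section \<open>Cosets of boxes and the Borel sets\<close>

text \<open>Cosets of a box are written with coefficients rather than absolute values, so that nesting,
  disjointness and translation can be read off from equations between coefficients.\<close>

definition coset_box :: "('n \<Rightarrow> int) \<Rightarrow> 'a::{field, finite} fls ^ 'n \<Rightarrow> ('a fls ^ 'n) set" where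
  "coset_box n a = {v. \<forall>i. \<forall>m < n i. v $ i $$ m = a $ i $$ m}"

lemma coset_box_refl: "a \<in> coset_box n a"
  by (simp add: coset_box_def)

lemma coset_box_eq: "b \<in> coset_box n a \<Longrightarrow> coset_box n b = coset_box n a"
  by (auto simp: coset_box_def)

lemma coset_box_antimono: "(\<And>i. n i \<le> m i) \<Longrightarrow> coset_box m a \<subseteq> coset_box n a"
  unfolding coset_box_def by (smt (verit) Collect_mono)

lemma translate_coset_box: "(+) a ` coset_box n b = coset_box n (a + b)"
proof (intro equalityI subsetI)
  fix v assume "v \<in> coset_box n (a + b)"
  then have "v - a \<in> coset_box n b"
    by (auto simp: coset_box_def)
  then show "v \<in> (+) a ` coset_box n b"
    by (intro image_eqI[of _ _ "v - a"]) auto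
qed (auto simp: coset_box_def)

text \<open>A ball of the metric on \<open>'a fls\<close>, which has base \<open>2\<close>, is a condition on the coefficients up to some index
  only; this turns openness into a statement about cosets of boxes.\<close>

lemma dist_fls_less_power_iff:
  fixes f g :: "'a::group_add fls"
  shows "dist f g < inverse (2 ^ k) \<longleftrightarrow> (\<forall>m \<le> int k. f $$ m = g $$ m)"
proof (cases "f = g")
  case False
  have "dist f g < inverse (2 ^ k) \<longleftrightarrow> int k < fls_subdegree (f - g)"
  proof (cases "fls_subdegree (f - g) \<ge> 0")
    case True
    then show ?thesis
      using False by (auto simp: dist_fls_def zless_nat_eq_int_zless)
  next
    case neg: False
    have "inverse (2 ^ k) \<le> (1::real)"
      by (simp add: inverse_le_1_iff)
    also have "(1::real) \<le> 2 ^ nat (- fls_subdegree (f - g))"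
      by simp
    finally show ?thesis
      using False neg by (simp add: dist_fls_def)
  qed
  also have "\<dots> \<longleftrightarrow> (\<forall>m \<le> int k. (f - g) $$ m = 0)"
  proof
    assume "int k < fls_subdegree (f - g)"
    then show "\<forall>m \<le> int k. (f - g) $$ m = 0"
      by (intro allI impI fls_eq0_below_subdegree) linarith
  next
    assume "\<forall>m \<le> int k. (f - g) $$ m = 0"
    then have "int k + 1 \<le> fls_subdegree (f - g)"
      using False by (intro fls_subdegree_geI) auto
    then show "int k < fls_subdegree (f - g)"
      by linarith
  qed
  finally show ?thesis
    by simp
qed simp

lemma open_fls_iff:
  fixes S :: "'a::group_add fls set"
  shows "open S \<longleftrightarrow> (\<forall>a\<in>S. \<exists>k::nat. \<forall>f. (\<forall>m < int k. f $$ m = a $$ m) \<longrightarrow> f \<in> S)"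
proof
  assume S: "open S"
  show "\<forall>a\<in>S. \<exists>k::nat. \<forall>f. (\<forall>m < int k. f $$ m = a $$ m) \<longrightarrow> f \<in> S"
  proof
    fix a assume "a \<in> S"
    with S obtain r where r: "r > 0" "\<And>y. dist y a < r \<Longrightarrow> y \<in> S"
      unfolding open_fls_def by blast
    from real_arch_pow_inv[OF r(1), of "1/2"] obtain k where "(1/2) ^ k < r" by auto
    then have k: "inverse (2 ^ k) < r"
      by (simp add: power_one_over inverse_eq_divide)
    have "\<forall>f. (\<forall>m < int (Suc k). f $$ m = a $$ m) \<longrightarrow> f \<in> S"
    proof (intro allI impI)
      fix f assume "\<forall>m < int (Suc k). f $$ m = a $$ m"
      then have "dist f a < inverse (2 ^ k)"
        unfolding dist_fls_less_power_iff by auto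
      then show "f \<in> S"
        using r(2) k by auto
    qed
    then show "\<exists>k::nat. \<forall>f. (\<forall>m < int k. f $$ m = a $$ m) \<longrightarrow> f \<in> S" ..
  qed
next
  assume S: "\<forall>a\<in>S. \<exists>k::nat. \<forall>f. (\<forall>m < int k. f $$ m = a $$ m) \<longrightarrow> f \<in> S"
  show "open S"
    unfolding open_fls_def
  proof
    fix a assume "a \<in> S"
    with S obtain k where k: "\<And>f. (\<forall>m < int k. f $$ m = a $$ m) \<Longrightarrow> f \<in> S" by blast
    have "{y. dist y a < inverse (2 ^ k)} \<subseteq> S"
      using k unfolding dist_fls_less_power_iff by auto
    then show "\<exists>r>0. {y. dist y a < r} \<subseteq> S"
      by (intro exI[of _ "inverse (2 ^ k)"]) auto
  qed
qed

lemma open_vec_fls_iff: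
  fixes S :: "('a::{field, finite} fls ^ 'n) set"
  shows "open S \<longleftrightarrow> (\<forall>a\<in>S. \<exists>k::nat. coset_box (\<lambda>_. int k) a \<subseteq> S)"
proof
  assume S: "open S"
  show "\<forall>a\<in>S. \<exists>k::nat. coset_box (\<lambda>_. int k) a \<subseteq> S"
  proof
    fix a assume "a \<in> S"
    with S obtain U where U: "\<And>i. open (U i)" "\<And>i. a $ i \<in> U i"
        "\<And>y. (\<And>i. y $ i \<in> U i) \<Longrightarrow> y \<in> S"
      unfolding open_vec_def by metis
    from U have "\<forall>i. \<exists>k::nat. \<forall>f. (\<forall>m < int k. f $$ m = a $ i $$ m) \<longrightarrow> f \<in> U i"
      unfolding open_fls_iff by blast
    then obtain k where k: "\<And>i f. (\<forall>m < int (k i). f $$ m = a $ i $$ m) \<Longrightarrow> f \<in> U i"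
      by metis
    have "int (k i) \<le> int (\<Sum>i\<in>UNIV. k i)" for i
      by (intro of_nat_mono member_le_sum) auto
    then have "coset_box (\<lambda>_. int (\<Sum>i\<in>UNIV. k i)) a \<subseteq> coset_box (\<lambda>i. int (k i)) a"
      by (rule coset_box_antimono)
    also have "\<dots> \<subseteq> S"
      by (intro subsetI U(3) k) (auto simp: coset_box_def)
    finally have "coset_box (\<lambda>_. int (\<Sum>i\<in>UNIV. k i)) a \<subseteq> S" .
    then show "\<exists>k::nat. coset_box (\<lambda>_. int k) a \<subseteq> S" ..
  qed
next
  assume S: "\<forall>a\<in>S. \<exists>k::nat. coset_box (\<lambda>_. int k) a \<subseteq> S"
  show "open S"
    unfolding open_vec_def
  proof
    fix a assume "a \<in> S"
    with S obtain k where k: "coset_box (\<lambda>_. int k) a \<subseteq> S" by blast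
    define U where "U i = {f. \<forall>m < int k. f $$ m = a $ i $$ m}" for i
    have "open (U i)" for i
      unfolding open_fls_iff U_def by (intro ballI exI[of _ k]) simp
    moreover have "y \<in> S" if "\<And>i. y $ i \<in> U i" for y
      using that k by (auto simp: U_def coset_box_def)
    ultimately show "\<exists>A. (\<forall>i. open (A i) \<and> a $ i \<in> A i) \<and> (\<forall>y. (\<forall>i. y $ i \<in> A i) \<longrightarrow> y \<in> S)"
      by (intro exI[of _ U]) (auto simp: U_def)
  qed
qed

lemma open_coset_box: "open (coset_box n a)"
  unfolding open_vec_fls_iff
proof
  fix b assume b: "b \<in> coset_box n a"
  have "n i \<le> int (nat (\<Sum>i\<in>UNIV. \<bar>n i\<bar>))" for i
    using member_le_sum[of i UNIV "\<lambda>i. \<bar>n i\<bar>"] by auto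
  then have "coset_box (\<lambda>_. int (nat (\<Sum>i\<in>UNIV. \<bar>n i\<bar>))) b \<subseteq> coset_box n b"
    by (rule coset_box_antimono)
  then show "\<exists>k::nat. coset_box (\<lambda>_. int k) b \<subseteq> coset_box n a"
    unfolding coset_box_eq[OF b] by (rule exI)
qed

lemma coset_box_in_borel: "coset_box n a \<in> sets borel"
  by (simp add: open_coset_box)

text \<open>The empty set is included to make the family closed under intersections.\<close>

definition cubes :: "('a::{field, finite} fls ^ 'n) set set" where
  "cubes = insert {} (range (\<lambda>(k, a). coset_box (\<lambda>_. int k) a))"

lemma cubesI: "coset_box (\<lambda>_. int k) a \<in> cubes"
  unfolding cubes_def by auto

text \<open>The coefficients below \<open>k\<close> form a polynomial in \<open>x\<close>, up to a shift. This labels the cosets of a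
  cube by elements of a countable type, which is why there are only countably many of them.\<close>

definition truncation :: "nat \<Rightarrow> 'a::{field, finite} fls ^ 'n \<Rightarrow> 'n \<Rightarrow> 'a poly" where
  "truncation k v i = fls_prpart (fls_shift (int k) (v $ i))"

lemma mem_coset_box_iff_truncation:
  "v \<in> coset_box (\<lambda>_. int k) a \<longleftrightarrow> truncation k v = truncation k a"
proof -
  have "truncation k v = truncation k a \<longleftrightarrow>
      (\<forall>i j. j \<noteq> 0 \<longrightarrow> v $ i $$ (int k - int j) = a $ i $$ (int k - int j))"
    unfolding truncation_def fun_eq_iff poly_eq_iff by (simp add: add.commute)
  also have "\<dots> \<longleftrightarrow> (\<forall>i. \<forall>m < int k. v $ i $$ m = a $ i $$ m)"
  proof safe
    fix i m assume *: "\<forall>i j. j \<noteq> 0 \<longrightarrow> v $ i $$ (int k - int j) = a $ i $$ (int k - int j)" "m < int k"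
    show "v $ i $$ m = a $ i $$ m"
      using *(1)[rule_format, of "nat (int k - m)" i] *(2) by simp
  next
    fix i and j :: nat assume "\<forall>i. \<forall>m < int k. v $ i $$ m = a $ i $$ m" "j > 0"
    then show "v $ i $$ (int k - int j) = a $ i $$ (int k - int j)"
      by simp
  qed
  finally show ?thesis
    by (simp add: coset_box_def)
qed

instance poly :: ("{countable, zero}") countable
  by (rule countable_classI[of "\<lambda>p. to_nat (coeffs p)"]) (simp add: coeffs_eq_iff)

lemma countable_cubes: "countable (cubes :: ('a::{field, finite} fls ^ 'n) set set)"
proof -
  have "cubes \<subseteq> insert {} (range (\<lambda>(k, P). {v :: 'a fls ^ 'n. truncation k v = P}))"
  proof
    fix B :: "('a fls ^ 'n) set" assume "B \<in> cubes"
    then consider "B = {}" | k a where "B = coset_box (\<lambda>_. int k) a"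
      unfolding cubes_def by auto
    then show "B \<in> insert {} (range (\<lambda>(k, P). {v. truncation k v = P}))"
    proof cases
      case (2 k a)
      then have "B = (\<lambda>(k, P). {v. truncation k v = P}) (k, truncation k a)"
        using mem_coset_box_iff_truncation[of _ k a] by auto
      then show ?thesis
        by blast
    qed simp
  qed
  then show ?thesis
    by (rule countable_subset) auto
qed

lemma Int_stable_cubes: "Int_stable cubes"
proof -
  have *: "coset_box (\<lambda>_. int k) a \<inter> coset_box (\<lambda>_. int l) b \<in> cubes" if "k \<le> l" for k l a b
  proof (cases "coset_box (\<lambda>_. int k) a \<inter> coset_box (\<lambda>_. int l) b = {}")
    case False
    then obtain c where c: "c \<in> coset_box (\<lambda>_. int k) a" "c \<in> coset_box (\<lambda>_. int l) b"
      by auto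
    have "coset_box (\<lambda>_. int l) c \<subseteq> coset_box (\<lambda>_. int k) c"
      using that by (intro coset_box_antimono) auto
    then have "coset_box (\<lambda>_. int k) a \<inter> coset_box (\<lambda>_. int l) b = coset_box (\<lambda>_. int l) c"
      using coset_box_eq[OF c(1)] coset_box_eq[OF c(2)] by auto
    then show ?thesis
      by (simp add: cubesI)
  qed (simp add: cubes_def)
  show ?thesis
  proof (rule Int_stableI)
    fix A B :: "('a fls ^ 'b) set" assume "A \<in> cubes" "B \<in> cubes"
    then consider "A \<inter> B = {}" | k a l b where "A = coset_box (\<lambda>_. int k) a" "B = coset_box (\<lambda>_. int l) b"
      unfolding cubes_def by auto
    then show "A \<inter> B \<in> cubes"
    proof cases
      case 2
      then show ?thesis
        using *[of k l a b] *[of l k b a] by (cases "k \<le> l") (auto simp: Int_commute)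
    qed (simp add: cubes_def)
  qed
qed

lemma sets_borel_eq_cubes: "sets borel = sigma_sets UNIV (cubes :: ('a::{field, finite} fls ^ 'n) set set)"
proof -
  have "borel = sigma UNIV (cubes :: ('a fls ^ 'n) set set)"
  proof (rule borel_eq_countable_basis[OF countable_cubes], rule topological_basisI)
    fix U :: "('a fls ^ 'n) set" assume "U \<in> cubes"
    then show "open U"
      unfolding cubes_def by (auto simp: open_coset_box)
  next
    fix U :: "('a fls ^ 'n) set" and a assume "open U" "a \<in> U"
    then obtain k :: nat where "coset_box (\<lambda>_. int k) a \<subseteq> U"
      unfolding open_vec_fls_iff by blast
    then show "\<exists>B\<in>cubes. a \<in> B \<and> B \<subseteq> U"
      by (intro bexI[of _ "coset_box (\<lambda>_. int k) a"] conjI coset_box_refl cubesI)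
  qed
  then have "sets borel = sets (sigma UNIV (cubes :: ('a fls ^ 'n) set set))"
    by (rule arg_cong)
  then show ?thesis
    by simp
qed

text \<open>The main tool for comparing measures: two cubes are nested or disjoint, so the cubes with the
  empty set are closed under intersection, and they generate the Borel sets.\<close>

lemma measure_eqI_cubes:
  fixes M N :: "('a::{field, finite} fls ^ 'n) measure"
  assumes "sets M = sets borel" "sets N = sets borel"
    and "\<And>k a. emeasure M (coset_box (\<lambda>_. int k) a) = emeasure N (coset_box (\<lambda>_. int k) a)"
    and "\<And>k a. emeasure M (coset_box (\<lambda>_. int k) a) \<noteq> \<infinity>"
  shows "M = N"
proof (rule measure_eqI_generator_eq_countable[OF Int_stable_cubes _ _ _ _ _ _ countable_cubes])
  show "emeasure M X = emeasure N X" if "X \<in> cubes" for X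
    using that assms(3) by (auto simp: cubes_def)
  show "\<Union>cubes = (UNIV :: ('a fls ^ 'n) set)"
    by (intro UNIV_eq_I[symmetric] UnionI[OF cubesI[of 0] coset_box_refl])
  show "emeasure M X \<noteq> \<infinity>" if "X \<in> cubes" for X
    using that assms(4) by (auto simp: cubes_def)
qed (simp_all add: assms(1,2) sets_borel_eq_cubes)

section \<open>Uniqueness of Haar measure and the volume of a box\<close>

lemma haar_measure_translate:
  assumes "haar_measure M" "A \<in> sets borel"
  shows "emeasure M ((+) a ` A) = emeasure M A"
  using assms unfolding haar_measure_def by blast

text \<open>Raising the cutoff at \<open>i\<close> by \<open>1\<close> fixes one more coefficient, which can take \<open>q\<close> values. Each value
  gives a translate of the smaller box.\<close>

lemma coset_box_split:
  "coset_box n a = (\<Union>c. coset_box (n(i := n i + 1)) (a + axis i (fls_shift (- n i) (fls_const c))))"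
proof (intro equalityI subsetI)
  fix v assume v: "v \<in> coset_box n a"
  define c where "c = v $ i $$ n i - a $ i $$ n i"
  have "v \<in> coset_box (n(i := n i + 1)) (a + axis i (fls_shift (- n i) (fls_const c)))"
    using v by (auto simp: coset_box_def axis_def c_def)
  then show "v \<in> (\<Union>c. coset_box (n(i := n i + 1)) (a + axis i (fls_shift (- n i) (fls_const c))))"
    by blast
next
  fix v assume "v \<in> (\<Union>c. coset_box (n(i := n i + 1)) (a + axis i (fls_shift (- n i) (fls_const c))))"
  then obtain c where v: "v \<in> coset_box (n(i := n i + 1)) (a + axis i (fls_shift (- n i) (fls_const c)))"
    by blast
  have "v $ j $$ m = a $ j $$ m" if "m < n j" for j m
    using v that unfolding coset_box_def by (cases "j = i") (auto simp: axis_def)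
  then show "v \<in> coset_box n a"
    by (simp add: coset_box_def)
qed

lemma haar_measure_coset_box_step:
  fixes M :: "('a::{field, finite} fls ^ 'n) measure"
  assumes M: "haar_measure M"
  shows "emeasure M (coset_box n 0) = of_nat CARD('a) * emeasure M (coset_box (n(i := n i + 1)) 0)"
proof -
  let ?F = "\<lambda>c::'a. coset_box (n(i := n i + 1)) (0 + axis i (fls_shift (- n i) (fls_const c)))"
  have sets: "sets M = sets borel"
    using M by (simp add: haar_measure_def)
  have "disjoint_family ?F"
    unfolding disjoint_family_on_def
  proof (intro ballI impI)
    fix c d :: 'a assume "c \<noteq> d"
    have digit: "v $ i $$ n i = e" if "v \<in> ?F e" for v e
    proof -
      from that have "\<forall>m < n i + 1. v $ i $$ m = axis i (fls_shift (- n i) (fls_const e)) $ i $$ m"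
        unfolding coset_box_def by (auto dest: spec[of _ i])
      then show ?thesis
        by simp
    qed
    then have "c = d" if "v \<in> ?F c" "v \<in> ?F d" for v
      using that by metis
    with \<open>c \<noteq> d\<close> show "?F c \<inter> ?F d = {}"
      by blast
  qed
  then have "emeasure M (\<Union>c. ?F c) = (\<Sum>c\<in>UNIV. emeasure M (?F c))"
    by (intro sum_emeasure[symmetric]) (auto simp: sets coset_box_in_borel)
  also have "\<dots> = (\<Sum>c\<in>(UNIV::'a set). emeasure M (coset_box (n(i := n i + 1)) 0))"
  proof (rule sum.cong)
    fix c :: 'a
    show "emeasure M (?F c) = emeasure M (coset_box (n(i := n i + 1)) 0)"
      using haar_measure_translate[OF M coset_box_in_borel[of "n(i := n i + 1)" 0],
          of "axis i (fls_shift (- n i) (fls_const c))"]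
      by (simp add: translate_coset_box)
  qed simp
  finally show ?thesis
    unfolding coset_box_split[of n "0 :: 'a fls ^ 'n" i] by simp
qed

lemma haar_measure_coset_box_add:
  fixes M :: "('a::{field, finite} fls ^ 'n) measure"
  assumes M: "haar_measure M"
  shows "emeasure M (coset_box (n(i := n i + k)) 0)
       = ennreal (real CARD('a) powi (- k)) * emeasure M (coset_box n 0)"
proof (induction k rule: int_induct[of _ 0])
  case base
  then show ?case by simp
next
  case (step1 k)
  let ?m = "n(i := n i + k)"
  have "emeasure M (coset_box ?m 0) = of_nat CARD('a) * emeasure M (coset_box (n(i := n i + (k + 1))) 0)"
    using haar_measure_coset_box_step[OF M, of ?m i] by (simp add: add.assoc)
  then have "ennreal (1 / real CARD('a)) * emeasure M (coset_box ?m 0)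
      = ennreal (1 / real CARD('a)) * (ennreal (real CARD('a)) * emeasure M (coset_box (n(i := n i + (k + 1))) 0))"
    by (simp add: ennreal_of_nat_eq_real_of_nat)
  also have "\<dots> = emeasure M (coset_box (n(i := n i + (k + 1))) 0)"
    by (simp add: mult.assoc[symmetric] ennreal_mult[symmetric])
  finally have "emeasure M (coset_box (n(i := n i + (k + 1))) 0)
      = ennreal (1 / real CARD('a)) * emeasure M (coset_box ?m 0)" by simp
  also have "\<dots> = ennreal (1 / real CARD('a) * real CARD('a) powi (- k)) * emeasure M (coset_box n 0)"
    unfolding step1(2) by (simp add: mult.assoc[symmetric] ennreal_mult[symmetric])
  also have "1 / real CARD('a) * real CARD('a) powi (- k) = real CARD('a) powi (- (k + 1))"
    using power_int_add[of "real CARD('a)" "-k" "-1"] by (simp add: field_simps)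
  finally show ?case .
next
  case (step2 k)
  let ?m = "n(i := n i + (k - 1))"
  have "emeasure M (coset_box ?m 0) = of_nat CARD('a) * emeasure M (coset_box (n(i := n i + k)) 0)"
    using haar_measure_coset_box_step[OF M, of ?m i] by simp
  also have "\<dots> = ennreal (real CARD('a) * real CARD('a) powi (- k)) * emeasure M (coset_box n 0)"
    unfolding step2(2) by (simp add: ennreal_mult mult.assoc ennreal_of_nat_eq_real_of_nat)
  also have "real CARD('a) * real CARD('a) powi (- k) = real CARD('a) powi (- (k - 1))"
    using power_int_add[of "real CARD('a)" "-k" 1] by (simp add: field_simps)
  finally show ?case .
qed

text \<open>Volumes of boxes follow from translation invariance alone: starting from the unit box, each
  cutoff is moved to its place, and every unit step changes the measure by the factor \<open>q\<close>.\<close>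

lemma haar_measure_coset_box:
  fixes M :: "('a::{field, finite} fls ^ 'n) measure"
  assumes M: "haar_measure M" and norm: "emeasure M (coset_box (\<lambda>_. 0) 0) = 1"
  shows "emeasure M (coset_box n a) = ennreal (real CARD('a) powi (- (\<Sum>i\<in>UNIV. n i)))"
proof -
  have "emeasure M (coset_box (\<lambda>i. if i \<in> S then n i else 0) 0)
      = ennreal (real CARD('a) powi (- (\<Sum>i\<in>S. n i)))" if "finite S" for S
    using that
  proof (induction S rule: finite_induct)
    case (insert j S)
    have "(\<lambda>i. if i \<in> insert j S then n i else 0)
        = (\<lambda>i. if i \<in> S then n i else 0)(j := (if j \<in> S then n j else 0) + n j)"
      using insert by (auto simp: fun_eq_iff)
    then have "emeasure M (coset_box (\<lambda>i. if i \<in> insert j S then n i else 0) 0)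
        = ennreal (real CARD('a) powi (- n j) * real CARD('a) powi (- (\<Sum>i\<in>S. n i)))"
      using haar_measure_coset_box_add[OF M, of "\<lambda>i. if i \<in> S then n i else 0" j "n j"]
      by (simp add: insert ennreal_mult)
    also have "real CARD('a) powi (- n j) * real CARD('a) powi (- (\<Sum>i\<in>S. n i))
        = real CARD('a) powi (- (\<Sum>i\<in>insert j S. n i))"
      using insert by (simp add: power_int_add[symmetric])
    finally show ?case .
  qed (simp add: norm)
  from this[of UNIV] show ?thesis
    using haar_measure_translate[OF M coset_box_in_borel[of n 0], of a]
    by (simp add: translate_coset_box)
qed

lemma haar_measure_unique:
  fixes M N :: "('a::{field, finite} fls ^ 'n) measure"
  assumes "haar_measure M" "emeasure M (coset_box (\<lambda>_. 0) 0) = 1"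
    and "haar_measure N" "emeasure N (coset_box (\<lambda>_. 0) 0) = 1"
  shows "M = N"
proof (rule measure_eqI_cubes)
  show "sets M = sets borel" "sets N = sets borel"
    using assms by (auto simp: haar_measure_def)
qed (simp_all add: haar_measure_coset_box assms)

section \<open>Polynomials as Laurent series\<close>

lemma poly_to_fls_0 [simp]: "poly_to_fls 0 = 0"
  by (simp add: poly_to_fls_def)

lemma poly_to_fls_pCons: "poly_to_fls (pCons a p) = fls_const a + fls_X_inv * poly_to_fls p"
  by (simp add: poly_to_fls_def map_poly_pCons)

text \<open>A polynomial in \<open>x\<close> lives at the indices \<open>\<le> 0\<close>, because the index is the exponent of \<open>x\<^sup>-\<^sup>1\<close>.\<close>

lemma poly_to_fls_nth: "poly_to_fls p $$ m = (if m \<le> 0 then coeff p (nat (- m)) else 0)"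
proof (induction p arbitrary: m)
  case (pCons a p)
  consider "m > 0" | "m = 0" | "m < 0" by linarith
  then show ?case
  proof cases
    case 3
    then have "nat (- m) = Suc (nat (- (m + 1)))" by auto
    with 3 pCons show ?thesis
      by (simp add: poly_to_fls_pCons fls_X_inv_times_conv_shift)
  qed (simp_all add: poly_to_fls_pCons fls_X_inv_times_conv_shift pCons)
qed simp

lemma one_less_card: "1 < CARD('a::{field, finite})"
proof -
  have "card {0, 1 :: 'a} \<le> CARD('a)"
    by (intro card_mono) auto
  then show ?thesis by simp
qed

section \<open>Existence of Haar measure\<close>

text \<open>The pair \<open>(P, f)\<close> is the list of all digits of a vector: \<open>P\<close> holds those at negative indices and
  \<open>f\<close> the others. The polynomials \<open>P i\<close> are multiplied by \<open>x\<close> to make this a bijection.\<close>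

definition vec_of_digits :: "('n \<Rightarrow> 'a poly) \<times> ('n \<times> nat \<Rightarrow> 'a) \<Rightarrow> 'a::{field, finite} fls ^ 'n" where
  "vec_of_digits = (\<lambda>(P, f). \<chi> i. poly_to_fls (pCons 0 (P i)) + fps_to_fls (Abs_fps (\<lambda>j. f (i, j))))"

lemma vec_of_digits_nth:
  "vec_of_digits (P, f) $ i $$ m = (if m < 0 then coeff (P i) (nat (- m - 1)) else f (i, nat m))"
proof (cases "m < 0")
  case True
  then have "nat (- m) = Suc (nat (- m - 1))" by auto
  with True show ?thesis
    by (simp add: vec_of_digits_def poly_to_fls_nth)
qed (auto simp: vec_of_digits_def poly_to_fls_nth)

definition polar_digits :: "'a::{field, finite} fls ^ 'n \<Rightarrow> 'n \<Rightarrow> 'a poly" where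
  "polar_digits a i = poly_shift 1 (fls_prpart (a $ i))"

text \<open>In terms of digits a coset of a cube of side at most \<open>1\<close> is a cylinder: it prescribes \<open>P\<close> completely
  and finitely many values of \<open>f\<close>. Hence its preimage is measurable and has a computable measure.\<close>

lemma vec_of_digits_in_cube_iff:
  "vec_of_digits (P, f) \<in> coset_box (\<lambda>_. int k) a
     \<longleftrightarrow> P = polar_digits a \<and> (\<forall>x\<in>UNIV \<times> {..<k}. f x \<in> {a $ fst x $$ int (snd x)})"
proof (intro iffI conjI)
  assume "vec_of_digits (P, f) \<in> coset_box (\<lambda>_. int k) a"
  then have eq: "(if m < 0 then coeff (P i) (nat (- m - 1)) else f (i, nat m)) = a $ i $$ m"
    if "m < int k" for i m
    using that unfolding coset_box_def vec_of_digits_nth[symmetric] by blast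
  show "P = polar_digits a"
  proof (intro ext poly_eqI)
    fix i j
    show "coeff (P i) j = coeff (polar_digits a i) j"
      using eq[of "- int j - 1" i] by (simp add: polar_digits_def coeff_poly_shift minus_diff_commute)
  qed
  show "\<forall>x\<in>UNIV \<times> {..<k}. f x \<in> {a $ fst x $$ int (snd x)}"
    using eq[of "int _"] by auto
next
  assume *: "P = polar_digits a \<and> (\<forall>x\<in>UNIV \<times> {..<k}. f x \<in> {a $ fst x $$ int (snd x)})"
  show "vec_of_digits (P, f) \<in> coset_box (\<lambda>_. int k) a"
    unfolding coset_box_def
  proof (intro CollectI allI impI)
    fix i m assume m: "m < int k"
    show "vec_of_digits (P, f) $ i $$ m = a $ i $$ m"
    proof (cases "m < 0")
      case True
      then have "int (Suc (nat (- m - 1))) = - m" by simp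
      then show ?thesis
        using True * by (simp add: vec_of_digits_nth polar_digits_def coeff_poly_shift del: of_nat_Suc)
    next
      case False
      then show ?thesis
        using * m by (auto simp: vec_of_digits_nth dest!: bspec[of _ _ "(i, nat m)"])
    qed
  qed
qed

definition digit_measure :: "(('n::finite \<Rightarrow> 'a::{field, finite} poly) \<times> ('n \<times> nat \<Rightarrow> 'a)) measure" where
  "digit_measure = count_space UNIV \<Otimes>\<^sub>M PiM UNIV (\<lambda>_. uniform_count_measure UNIV)"

definition standard_haar :: "('a::{field, finite} fls ^ 'n) measure" where
  "standard_haar = distr digit_measure borel vec_of_digits"

lemma
  shows vimage_vec_of_digits_cube:
      "vec_of_digits -` coset_box (\<lambda>_. int k) a \<inter> space (digit_measure :: (('n::finite \<Rightarrow> 'a::{field, finite} poly) \<times> _) measure) \<in> sets digit_measure" (is ?A)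
    and emeasure_vimage_vec_of_digits_cube:
      "emeasure digit_measure (vec_of_digits -` coset_box (\<lambda>_. int k) a \<inter> space (digit_measure :: (('n \<Rightarrow> 'a poly) \<times> _) measure))
         = ennreal ((1 / real CARD('a)) ^ (CARD('n) * k))" (is ?B)
proof -
  let ?U = "uniform_count_measure (UNIV :: 'a set)"
  interpret U: prob_space ?U
    by (rule prob_space_uniform_count_measure) auto
  interpret D: product_prob_space "\<lambda>_ :: 'n \<times> nat. ?U" UNIV
    by unfold_locales
  let ?D = "PiM (UNIV :: ('n \<times> nat) set) (\<lambda>_. ?U)"
  let ?J = "(UNIV :: 'n set) \<times> {..<k}"
  let ?C = "{f \<in> space ?D. \<forall>x\<in>?J. f x \<in> {a $ fst x $$ int (snd x)}}"
  \<comment> \<open>By \<open>vec_of_digits_in_cube_iff\<close>, a single \<open>P\<close> contributes, and it carries counting measure \<open>1\<close>.\<close>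
  have eq: "vec_of_digits -` coset_box (\<lambda>_. int k) a \<inter> space digit_measure = {polar_digits a} \<times> ?C"
    by (auto simp: vec_of_digits_in_cube_iff digit_measure_def space_pair_measure space_PiM)
  have C: "?C \<in> sets ?D"
    by measurable
  show ?A
    unfolding eq using C by (auto simp: digit_measure_def)
  have "emeasure ?D ?C = (\<Prod>x\<in>?J. emeasure ?U {a $ fst x $$ int (snd x)})"
    by (intro D.emeasure_PiM_Collect) auto
  also have "\<dots> = (\<Prod>x\<in>?J. ennreal (1 / real CARD('a)))"
    by (intro prod.cong refl) (simp add: emeasure_uniform_count_measure)
  also have "\<dots> = ennreal ((1 / real CARD('a)) ^ (CARD('n) * k))"
    by (simp add: ennreal_power)
  finally have "emeasure ?D ?C = ennreal ((1 / real CARD('a)) ^ (CARD('n) * k))" .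
  then show ?B
    unfolding eq unfolding digit_measure_def using C
    by (subst D.emeasure_pair_measure_Times) auto
qed

lemma measurable_borelI_cubes:
  fixes f :: "'b \<Rightarrow> 'a::{field, finite} fls ^ 'n"
  assumes "\<And>k a. f -` coset_box (\<lambda>_. int k) a \<inter> space M \<in> sets M"
  shows "f \<in> borel_measurable M"
proof (rule measurable_sigma_sets[OF sets_borel_eq_cubes])
  show "f -` A \<inter> space M \<in> sets M" if "A \<in> cubes" for A
    using that assms unfolding cubes_def by auto
qed auto

lemma measurable_vec_of_digits: "vec_of_digits \<in> borel_measurable digit_measure"
  by (intro measurable_borelI_cubes vimage_vec_of_digits_cube)

lemma emeasure_standard_haar_cube:
  fixes a :: "'a::{field, finite} fls ^ 'n"
  shows "emeasure standard_haar (coset_box (\<lambda>_. int k) a) = ennreal ((1 / real CARD('a)) ^ (CARD('n) * k))"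
  unfolding standard_haar_def
  by (subst emeasure_distr[OF measurable_vec_of_digits coset_box_in_borel])
     (rule emeasure_vimage_vec_of_digits_cube)

lemma vimage_translate_coset_box:
  fixes a :: "'a::{field, finite} fls ^ 'n"
  shows "(\<lambda>v. v - a) -` coset_box n b = coset_box n (a + b)"
  by (auto simp: coset_box_def algebra_simps eq_diff_eq diff_eq_eq)

text \<open>The measure of the coset of a cube depends only on its size, so the translated measure agrees
  with the original one on cubes, hence everywhere.\<close>

lemma standard_haar_translate:
  fixes a :: "'a::{field, finite} fls ^ 'n"
  assumes A: "A \<in> sets borel"
  shows "emeasure standard_haar ((+) a ` A) = emeasure standard_haar A"
proof -
  have [simp]: "sets standard_haar = sets borel" "space standard_haar = UNIV"
    by (simp_all add: standard_haar_def)
  have meas: "(\<lambda>v. v - a) \<in> borel_measurable standard_haar"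
    by (rule measurable_borelI_cubes) (simp add: vimage_translate_coset_box coset_box_in_borel)
  have "distr standard_haar borel (\<lambda>v. v - a) = standard_haar"
  proof (rule measure_eqI_cubes)
    fix k b
    show "emeasure (distr standard_haar borel (\<lambda>v. v - a)) (coset_box (\<lambda>_. int k) b)
        = emeasure standard_haar (coset_box (\<lambda>_. int k) b)"
      by (subst emeasure_distr[OF meas coset_box_in_borel])
         (simp add: vimage_translate_coset_box emeasure_standard_haar_cube)
    show "emeasure (distr standard_haar borel (\<lambda>v. v - a)) (coset_box (\<lambda>_. int k) b) \<noteq> \<infinity>"
      by (subst emeasure_distr[OF meas coset_box_in_borel])
         (simp add: vimage_translate_coset_box emeasure_standard_haar_cube)
  qed simp_all
  moreover have "(+) a ` A = (\<lambda>v. v - a) -` A"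
    by (auto intro: image_eqI[of _ _ "_ - a"])
  ultimately show ?thesis
    using emeasure_distr[OF meas A] by simp
qed

lemma emeasure_standard_haar_compact:
  fixes C :: "('a::{field, finite} fls ^ 'n) set"
  assumes "compact C"
  shows "emeasure standard_haar C < \<infinity>"
proof -
  have sets: "sets standard_haar = sets (borel :: ('a fls ^ 'n) measure)"
    by (simp add: standard_haar_def)
  obtain F where F: "F \<subseteq> C" "finite F" "C \<subseteq> (\<Union>a\<in>F. coset_box (\<lambda>_. int 0) a)"
  proof (rule compactE_image[OF assms, of C "coset_box (\<lambda>_. int 0)"])
    show "C \<subseteq> (\<Union>a\<in>C. coset_box (\<lambda>_. int 0) a)"
      using coset_box_refl by (intro subsetI) (rule UN_I)
  qed (rule open_coset_box)
  have "emeasure standard_haar C \<le> emeasure standard_haar (\<Union>a\<in>F. coset_box (\<lambda>_. int 0) a)"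
    using F by (intro emeasure_mono) (auto simp: sets coset_box_in_borel)
  also have "\<dots> \<le> (\<Sum>a\<in>F. emeasure standard_haar (coset_box (\<lambda>_. int 0) a))"
    using F by (intro emeasure_subadditive_finite) (auto simp: sets coset_box_in_borel)
  also have "\<dots> < \<infinity>"
    unfolding emeasure_standard_haar_cube by (simp add: of_nat_less_top)
  finally show ?thesis .
qed

lemma emeasure_standard_haar_open:
  fixes U :: "('a::{field, finite} fls ^ 'n) set"
  assumes U: "open U" "U \<noteq> {}"
  shows "0 < emeasure standard_haar U"
proof -
  obtain a k where ak: "coset_box (\<lambda>_. int k) a \<subseteq> U"
    using U unfolding open_vec_fls_iff by blast
  have "0 < emeasure standard_haar (coset_box (\<lambda>_. int k) a)"
    by (simp add: emeasure_standard_haar_cube)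
  also have "\<dots> \<le> emeasure standard_haar U"
    using U ak by (intro emeasure_mono) (auto simp: standard_haar_def)
  finally show ?thesis .
qed

lemma haar_measure_standard_haar: "haar_measure (standard_haar :: ('a::{field, finite} fls ^ 'n) measure)"
proof -
  have "sets standard_haar = sets (borel :: ('a fls ^ 'n) measure)"
    by (simp add: standard_haar_def)
  then show ?thesis
    unfolding haar_measure_def
    using standard_haar_translate emeasure_standard_haar_compact emeasure_standard_haar_open
    by blast
qed

section \<open>Boxes in terms of cutoffs\<close>

text \<open>The absolute value takes only integral powers of \<open>q\<close>, so a real radius may be rounded down to
  such a power without changing the ball.\<close>

lemma fls_abs_le_iff:
  fixes f :: "'a::{field, finite} fls"
  assumes "r > 0"
  shows "fls_abs f \<le> r \<longleftrightarrow> (\<forall>m < - \<lfloor>log (real CARD('a)) r\<rfloor>. f $$ m = 0)"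
proof (cases "f = 0")
  case False
  have q: "1 < real CARD('a)"
    using one_less_card[where 'a = 'a] by simp
  have "fls_abs f \<le> r \<longleftrightarrow> real CARD('a) powr real_of_int (- fls_subdegree f) \<le> r"
    using False q by (simp add: fls_abs_def powr_real_of_int' del: of_int_minus)
  also have "\<dots> \<longleftrightarrow> real_of_int (- fls_subdegree f) \<le> log (real CARD('a)) r"
    using assms q by (rule_tac le_log_iff[symmetric]) auto
  also have "\<dots> \<longleftrightarrow> - fls_subdegree f \<le> \<lfloor>log (real CARD('a)) r\<rfloor>"
    by (rule le_floor_iff[symmetric])
  also have "\<dots> \<longleftrightarrow> - \<lfloor>log (real CARD('a)) r\<rfloor> \<le> fls_subdegree f"
    by linarith
  also have "\<dots> \<longleftrightarrow> (\<forall>m < - \<lfloor>log (real CARD('a)) r\<rfloor>. f $$ m = 0)"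
    using False fls_subdegree_geI[of f] by auto
  finally show ?thesis .
qed (use assms in \<open>simp add: fls_abs_def\<close>)

lemma box_set_eq_coset_box:
  assumes "\<And>i. r i > 0"
  shows "(box_set r :: ('a::{field, finite} fls ^ 'n) set)
       = coset_box (\<lambda>i. - \<lfloor>log (real CARD('a)) (r i)\<rfloor>) 0"
  using assms by (simp add: box_set_def coset_box_def fls_abs_le_iff)

lemma is_box_iff: "is_box (B :: ('a::{field, finite} fls ^ 'n) set) \<longleftrightarrow> (\<exists>n. B = coset_box n 0)"
proof
  assume "\<exists>n. B = coset_box n 0"
  then obtain n where n: "B = coset_box n 0" ..
  have q: "1 < real CARD('a)"
    using one_less_card[where 'a = 'a] by simp
  have "(box_set (\<lambda>i. real CARD('a) powr real_of_int (- n i)) :: ('a fls ^ 'n) set) = B"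
    using q by (subst box_set_eq_coset_box) (simp_all add: n)
  then show "is_box B"
    unfolding is_box_def using q by (intro exI[of _ "\<lambda>i. real CARD('a) powr real_of_int (- n i)"]) auto
qed (auto simp: is_box_def box_set_eq_coset_box)

text \<open>Existence and uniqueness of normalised Haar measure make the definite description in the
  definition of \<open>vol\<close> meaningful; the value is then the one forced by invariance.\<close>

lemma emeasure_vol_coset_box:
  "emeasure (vol :: ('a::{field, finite} fls ^ 'n) measure) (coset_box n a)
     = ennreal (real CARD('a) powi (- (\<Sum>i\<in>UNIV. n i)))"
proof -
  have unit: "{v :: 'a fls ^ 'n. \<forall>i. fls_abs (v $ i) \<le> 1} = coset_box (\<lambda>_. 0) 0"
    using box_set_eq_coset_box[of "\<lambda>_ :: 'n. 1", where 'a = 'a] by (simp add: box_set_def)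
  have "emeasure standard_haar (coset_box (\<lambda>_. 0) (0 :: 'a fls ^ 'n)) = 1"
    using emeasure_standard_haar_cube[of 0 "0 :: 'a fls ^ 'n"] by simp
  then have "(vol :: ('a fls ^ 'n) measure) = standard_haar"
    unfolding vol_def unit
    by (intro the_equality conjI haar_measure_standard_haar)
       (auto intro: haar_measure_unique haar_measure_standard_haar)
  with \<open>emeasure standard_haar (coset_box (\<lambda>_. 0) (0 :: 'a fls ^ 'n)) = 1\<close> show ?thesis
    by (simp add: haar_measure_coset_box haar_measure_standard_haar)
qed

section \<open>The polynomial part of a Laurent series\<close>

definition is_polynomial :: "'a::{field, finite} fls \<Rightarrow> bool" where
  "is_polynomial f \<longleftrightarrow> (\<exists>p. f = poly_to_fls p)"

lemma is_polynomial_poly_to_fls: "is_polynomial (poly_to_fls p)"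
  by (auto simp: is_polynomial_def)

text \<open>The decomposition of a Laurent series into a polynomial and a series of absolute value less
  than \<open>1\<close>; the second summand is \<open>f - g\<close>.\<close>

lemma polynomial_part:
  fixes f :: "'a::{field, finite} fls"
  obtains g where "is_polynomial g" "\<And>m. m \<le> 0 \<Longrightarrow> g $$ m = f $$ m"
proof
  let ?p = "poly_shift 1 (fls_prpart (fls_shift 1 f))"
  show "is_polynomial (poly_to_fls ?p)"
    by (rule is_polynomial_poly_to_fls)
  show "poly_to_fls ?p $$ m = f $$ m" if "m \<le> 0" for m
    using that by (simp add: poly_to_fls_nth coeff_poly_shift)
qed

lemma is_polynomial_iff: "is_polynomial f \<longleftrightarrow> (\<forall>m>0. f $$ m = 0)"
proof
  assume f: "\<forall>m>0. f $$ m = 0"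
  obtain g where g: "is_polynomial g" "\<And>m. m \<le> 0 \<Longrightarrow> g $$ m = f $$ m"
    using polynomial_part by blast
  have "g $$ m = f $$ m" for m
    using f g by (cases "m \<le> 0") (auto simp: is_polynomial_def poly_to_fls_nth)
  then have "g = f"
    by (simp add: fls_eq_iff)
  with g show "is_polynomial f"
    by simp
qed (auto simp: is_polynomial_def poly_to_fls_nth)

lemma is_polynomial_diff: "is_polynomial f \<Longrightarrow> is_polynomial g \<Longrightarrow> is_polynomial (f - g)"
  by (simp add: is_polynomial_iff)

lemma is_polynomial_sum: "(\<And>i. i \<in> S \<Longrightarrow> is_polynomial (f i)) \<Longrightarrow> is_polynomial (sum f S)"
  by (induction S rule: infinite_finite_induct) (auto simp: is_polynomial_iff)

lemma is_polynomial_1: "is_polynomial 1"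
  by (simp add: is_polynomial_iff)

lemma is_polynomial_mult: "is_polynomial f \<Longrightarrow> is_polynomial g \<Longrightarrow> is_polynomial (f * g)"
proof -
  have add: "poly_to_fls p + poly_to_fls q = poly_to_fls (p + q)" for p q :: "'a poly"
    by (rule fls_eqI) (simp add: poly_to_fls_nth)
  have "poly_to_fls p * poly_to_fls q = poly_to_fls (p * q)" for p q :: "'a poly"
  proof (induction p)
    case (pCons a p)
    have "fls_const a * poly_to_fls q = poly_to_fls (smult a q)"
      by (rule fls_eqI) (simp add: poly_to_fls_nth)
    moreover have "fls_X_inv * poly_to_fls (p * q) = poly_to_fls (pCons 0 (p * q))"
      by (simp add: poly_to_fls_pCons)
    moreover have "poly_to_fls (pCons a p) * poly_to_fls q
        = fls_const a * poly_to_fls q + fls_X_inv * (poly_to_fls p * poly_to_fls q)"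
      by (simp add: poly_to_fls_pCons distrib_right mult.assoc)
    ultimately have "poly_to_fls (pCons a p) * poly_to_fls q
        = poly_to_fls (smult a q) + poly_to_fls (pCons 0 (p * q))"
      using pCons by simp
    then show ?case
      by (simp only: add mult_pCons_left)
  qed simp
  then show "is_polynomial f \<Longrightarrow> is_polynomial g \<Longrightarrow> is_polynomial (f * g)"
    unfolding is_polynomial_def by blast
qed

lemma is_polynomial_prod: "(\<And>i. i \<in> S \<Longrightarrow> is_polynomial (f i)) \<Longrightarrow> is_polynomial (prod f S)"
  by (induction S rule: infinite_finite_induct) (auto simp: is_polynomial_1 is_polynomial_mult)

lemma is_polynomial_det:
  fixes A :: "'a::{field, finite} fls ^ 'n ^ 'n"
  assumes "\<And>i j. is_polynomial (A $ i $ j)"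
  shows "is_polynomial (det A)"
proof -
  have "is_polynomial (of_int (sign p) :: 'a fls)" for p :: "'n \<Rightarrow> 'n"
    by (simp add: sign_def is_polynomial_iff)
  then show ?thesis
    unfolding det_def using assms
    by (intro is_polynomial_sum is_polynomial_mult is_polynomial_prod) auto
qed

text \<open>A nonzero polynomial has absolute value at least \<open>1\<close>; a product of two polynomials that equals
  \<open>1\<close> therefore has factors of absolute value exactly \<open>1\<close>.\<close>

lemma is_polynomial_subdegree_le:
  "is_polynomial f \<Longrightarrow> f \<noteq> 0 \<Longrightarrow> fls_subdegree f \<le> 0"
  using nth_fls_subdegree_nonzero[of f] unfolding is_polynomial_iff by (meson not_le)

lemma polynomial_part_vec:
  fixes v :: "'a::{field, finite} fls ^ 'n"
  obtains u where "\<And>i. is_polynomial (u $ i)" "\<And>i m. m \<le> 0 \<Longrightarrow> u $ i $$ m = v $ i $$ m"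
proof -
  have "\<forall>i. \<exists>g. is_polynomial g \<and> (\<forall>m\<le>0. g $$ m = v $ i $$ m)"
    by (metis polynomial_part)
  then obtain g where "\<And>i. is_polynomial (g i)" "\<And>i m. m \<le> 0 \<Longrightarrow> g i $$ m = v $ i $$ m"
    by metis
  then show thesis
    by (intro that[of "\<chi> i. g i"]) auto
qed

section \<open>Order of vanishing of products and determinants\<close>

lemma fls_mult_nth_below:
  fixes f g :: "'a::field fls"
  assumes "\<forall>m<a. f $$ m = 0" "\<forall>m<b. g $$ m = 0" "m < a + b"
  shows "(f * g) $$ m = 0"
proof (cases "f = 0 \<or> g = 0")
  case False
  then have "a \<le> fls_subdegree f" "b \<le> fls_subdegree g"
    using assms by (auto intro: fls_subdegree_geI)
  then show ?thesis
    using assms(3) by (intro fls_times_nth_eq0) linarith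
qed auto

lemma fls_prod_nth_below:
  fixes f :: "'i \<Rightarrow> 'a::field fls"
  assumes "finite S" "\<And>i. i \<in> S \<Longrightarrow> \<forall>m < k i. f i $$ m = 0"
  shows "\<forall>m < sum k S. prod f S $$ m = 0"
  using assms
proof (induction S rule: finite_induct)
  case (insert i S)
  then show ?case
    using fls_mult_nth_below[of "k i" "f i" "sum k S" "prod f S"] by simp
qed simp

lemma fls_sum_nth: "sum f S $$ m = (\<Sum>i\<in>S. f i $$ m)"
  by (induction S rule: infinite_finite_induct) auto

text \<open>The ultrametric bound: the absolute value of an entry of \<open>A *v v\<close> is at most the product of the
  bounds for the entries of \<open>A\<close> and \<open>v\<close>.\<close>

lemma matrix_vector_mult_nth_below:
  fixes A :: "'a::{field, finite} fls ^ 'n ^ 'm"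
  assumes "\<And>j. \<forall>m<a. A $ i $ j $$ m = 0" "\<And>j. \<forall>m<b. v $ j $$ m = 0" "m < a + b"
  shows "(A *v v) $ i $$ m = 0"
proof -
  have "(A $ i $ j * v $ j) $$ m = 0" for j
    using assms by (intro fls_mult_nth_below[of a _ b])
  then show ?thesis
    by (simp add: matrix_vector_mult_def fls_sum_nth)
qed

text \<open>A nontrivial permutation \<open>p\<close> moves some index \<open>j\<close>, and the factor in row \<open>j\<close> starts at \<open>n (p j)\<close>
  rather than at \<open>n (p j) - 1\<close>. Its product therefore vanishes at the index at which the
  product along the diagonal starts, so no cancellation can occur there.\<close>

lemma det_subdegree_dominant_diagonal:
  fixes V :: "'a::{field, finite} fls ^ 'n ^ 'n"
  assumes low: "\<And>i j. i \<noteq> j \<Longrightarrow> \<forall>m < n j. V $ i $ j $$ m = 0"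
    and diag: "\<And>i. V $ i $ i \<noteq> 0" "\<And>i. fls_subdegree (V $ i $ i) = n i - 1"
  shows "det V \<noteq> 0" "fls_subdegree (det V) = (\<Sum>i\<in>UNIV. n i - 1)"
proof -
  let ?s = "\<Sum>i\<in>UNIV. n i - 1"
  define t where "t p = of_int (sign p) * (\<Prod>i\<in>UNIV. V $ i $ p i)" for p
  define D where "D = (\<Prod>i\<in>UNIV. V $ i $ i)"
  have D: "D \<noteq> 0" "fls_subdegree D = ?s"
  proof -
    show "D \<noteq> 0" by (simp add: D_def diag)
    have "(\<Prod>i\<in>S. V $ i $ i) \<noteq> 0 \<and> fls_subdegree (\<Prod>i\<in>S. V $ i $ i) = (\<Sum>i\<in>S. n i - 1)"
      if "finite S" for S
      using that by (induction S rule: finite_induct) (auto simp: diag)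
    then show "fls_subdegree D = ?s"
      by (simp add: D_def)
  qed
  have off: "t p $$ m = 0" if p: "p permutes UNIV" "p \<noteq> id" and m: "m \<le> ?s" for p m
  proof -
    from p obtain j where j: "p j \<noteq> j"
      by (auto simp: fun_eq_iff)
    let ?k = "\<lambda>i. if p i = i then n i - 1 else n (p i)"
    have van: "\<forall>m < ?k i. V $ i $ p i $$ m = 0" for i
      using low[of i "p i"] diag(2)[of i] fls_eq0_below_subdegree[of _ "V $ i $ i"] by auto
    \<comment> \<open>The strict inequality comes from the row \<open>j\<close>, which is off the diagonal.\<close>
    have "(\<Sum>i\<in>UNIV. n (p i) - 1) < (\<Sum>i\<in>UNIV. ?k i)"
      using j by (intro sum_strict_mono_ex1) auto
    also have "(\<Sum>i\<in>UNIV. n (p i) - 1) = ?s"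
      using sum.permute[OF p(1), of "\<lambda>i. n i - 1"] by (simp add: o_def)
    finally have "(\<Prod>i\<in>UNIV. V $ i $ p i) $$ m = 0"
      using fls_prod_nth_below[of UNIV ?k "\<lambda>i. V $ i $ p i"] van m by auto
    then show ?thesis
      by (auto simp: t_def sign_def)
  qed
  have "det V = (\<Sum>p | p permutes UNIV. t p)"
    by (simp add: det_def t_def)
  also have "\<dots> = t id + (\<Sum>p \<in> {p. p permutes UNIV} - {id}. t p)"
    by (intro sum.remove) (auto simp: permutes_id)
  also have "t id = D"
    by (simp add: t_def D_def sign_id)
  finally have det_eq: "det V = D + (\<Sum>p \<in> {p. p permutes UNIV} - {id}. t p)" .
  have eq: "det V $$ m = D $$ m" if "m \<le> ?s" for m
  proof -
    have "(\<Sum>p \<in> {p. p permutes UNIV} - {id}. t p) $$ m = 0"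
      unfolding fls_sum_nth using off that by (intro sum.neutral) blast
    then show ?thesis
      by (simp add: det_eq)
  qed
  have "det V $$ ?s \<noteq> 0"
    using eq[of ?s] D nth_fls_subdegree_nonzero[of D] by simp
  then show "det V \<noteq> 0" by auto
  show "fls_subdegree (det V) = ?s"
  proof (rule fls_subdegree_eqI)
    show "det V $$ ?s \<noteq> 0" by fact
    show "det V $$ m = 0" if "m < ?s" for m
      using that eq[of m] D by simp
  qed
qed

section \<open>Admissible and maximal boxes of a lattice\<close>

text \<open>The lattice is indexed by vectors with polynomial entries instead of vectors of polynomials, so
  that its elements can be computed with inside one matrix algebra over \<open>'a fls\<close>.\<close>

definition lattice_of :: "'a::{field, finite} fls ^ 'n ^ 'n \<Rightarrow> ('a fls ^ 'n) set" where
  "lattice_of g = {g *v u | u. \<forall>i. is_polynomial (u $ i)}"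

lemma unimodular_lattices_eq:
  "unimodular_lattices = {lattice_of g | g :: 'a::{field, finite} fls ^ 'n ^ 'n. invertible g \<and> fls_abs (det g) = 1}"
proof -
  have "{g *v (\<chi> i. poly_to_fls (p i)) | p. True} = lattice_of g" for g :: "'a fls ^ 'n ^ 'n"
  proof (intro equalityI subsetI)
    fix v assume "v \<in> lattice_of g"
    then obtain u where u: "v = g *v u" "\<forall>i. is_polynomial (u $ i)"
      by (auto simp: lattice_of_def)
    then obtain p where "\<And>i. u $ i = poly_to_fls (p i)"
      unfolding is_polynomial_def by metis
    then have "u = (\<chi> i. poly_to_fls (p i))"
      by (simp add: vec_eq_iff)
    with u show "v \<in> {g *v (\<chi> i. poly_to_fls (p i)) | p. True}"
      by blast
  next
    fix v assume "v \<in> {g *v (\<chi> i. poly_to_fls (p i)) | p. True}"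
    then obtain p where "v = g *v (\<chi> i. poly_to_fls (p i))"
      by blast
    then show "v \<in> lattice_of g"
      unfolding lattice_of_def
      by (intro CollectI exI[of _ "\<chi> i. poly_to_fls (p i)"]) (simp add: is_polynomial_poly_to_fls)
  qed
  then show ?thesis
    by (simp add: unimodular_lattices_def)
qed

lemma lattice_of_diff: "v \<in> lattice_of g \<Longrightarrow> w \<in> lattice_of g \<Longrightarrow> v - w \<in> lattice_of g"
proof -
  assume "v \<in> lattice_of g" "w \<in> lattice_of g"
  then obtain a b where "v = g *v a" "w = g *v b" "\<forall>i. is_polynomial (a $ i)" "\<forall>i. is_polynomial (b $ i)"
    by (auto simp: lattice_of_def)
  then show "v - w \<in> lattice_of g"
    unfolding lattice_of_def
    by (auto simp: matrix_vector_mult_diff_distrib intro!: exI[of _ "a - b"] is_polynomial_diff)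
qed

definition admissible_cutoff :: "'a::{field, finite} fls ^ 'n ^ 'n \<Rightarrow> ('n \<Rightarrow> int) \<Rightarrow> bool" where
  "admissible_cutoff g n \<longleftrightarrow> coset_box n 0 \<inter> lattice_of g = {0}"

lemma zero_in_lattice: "0 \<in> lattice_of g"
  by (auto simp: lattice_of_def is_polynomial_iff intro!: exI[of _ 0])

lemma admissible_cutoff_iff:
  "admissible_cutoff g n \<longleftrightarrow> (\<forall>v\<in>lattice_of g. v \<in> coset_box n 0 \<longrightarrow> v = 0)"
  using zero_in_lattice[of g] coset_box_refl[of 0 n] unfolding admissible_cutoff_def by blast

lemma admissible_cutoff_mono:
  assumes "admissible_cutoff g n" "\<And>i. n i \<le> m i"
  shows "admissible_cutoff g m"
  using assms coset_box_antimono[of n m 0] unfolding admissible_cutoff_iff by blast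

lemma common_cutoff:
  fixes A :: "'a::{field, finite} fls ^ 'n ^ 'm"
  obtains a where "\<And>i j. \<forall>m<a. A $ i $ j $$ m = 0"
proof -
  define a where "a = Min (range (\<lambda>(i, j). fls_subdegree (A $ i $ j)))"
  have "a \<le> fls_subdegree (A $ i $ j)" for i j
    unfolding a_def by (intro Min_le) (auto intro: image_eqI[of _ _ "(i, j)"])
  then show thesis
    by (intro that[of a]) (auto intro!: fls_eq0_below_subdegree dest: order_less_le_trans)
qed

text \<open>Discreteness of the lattice: applying the inverse matrix to a sufficiently short lattice vector
  gives a polynomial vector with entries of absolute value less than \<open>1\<close>, which is \<open>0\<close>.\<close>

lemma admissible_cutoff_exists:
  fixes g :: "'a::{field, finite} fls ^ 'n ^ 'n"
  assumes "invertible g"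
  obtains n where "admissible_cutoff g n"
proof -
  obtain h where h: "h ** g = mat 1"
    using assms unfolding invertible_def by blast
  obtain a where a: "\<And>i j. \<forall>m<a. h $ i $ j $$ m = 0"
    using common_cutoff by blast
  have "admissible_cutoff g (\<lambda>_. 1 - a)"
    unfolding admissible_cutoff_iff
  proof (intro ballI impI)
    fix v assume v: "v \<in> lattice_of g" "v \<in> coset_box (\<lambda>_. 1 - a) 0"
    then obtain u where u: "v = g *v u" "\<And>i. is_polynomial (u $ i)"
      by (auto simp: lattice_of_def)
    have hv: "h *v v = u"
      by (simp add: u matrix_vector_mul_assoc h)
    have "u $ i $$ m = 0" for i m
    proof (cases "m < 1")
      case True
      then show ?thesis
        unfolding hv[symmetric] using a v(2)
        by (intro matrix_vector_mult_nth_below[of a _ _ "1 - a"]) (auto simp: coset_box_def)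
    next
      case False
      then show ?thesis
        using u(2)[of i] by (simp add: is_polynomial_iff)
    qed
    then have "u = 0"
      by (simp add: vec_eq_iff fls_eq_iff)
    then show "v = 0"
      by (simp add: u)
  qed
  then show thesis ..
qed

text \<open>The vectors \<open>e k\<close>, which are powers of \<open>x\<close> in direction \<open>i\<close>, are moved by lattice vectors
  \<open>g *v u k\<close> to vectors \<open>r k\<close> in a fixed bounded set. That set is covered by finitely many cosets of
  the box with cutoff \<open>n\<close>, so two of the \<open>r k\<close> lie in the same one. The difference of the two
  lattice vectors then differs from \<open>e k - e l\<close> by a vector of the box: it is nonzero, and only
  its \<open>i\<close>-th coordinate can leave the box.\<close>

lemma long_box_not_admissible:
  fixes g :: "'a::{field, finite} fls ^ 'n ^ 'n"
  assumes "invertible g"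
  obtains l where "\<not> admissible_cutoff g (n(i := l))"
proof -
  obtain h where h: "g ** h = mat 1"
    using assms unfolding invertible_def by blast
  obtain a where a: "\<And>i j. \<forall>m<a. g $ i $ j $$ m = 0"
    using common_cutoff by blast
  \<comment> \<open>The exponents are so large that no two of the \<open>e k\<close> are congruent modulo the box.\<close>
  define e :: "nat \<Rightarrow> 'a fls ^ 'n" where "e k = axis i (fls_shift (int k - n i + 1) 1)" for k
  have "\<exists>u. (\<forall>j. is_polynomial (u $ j)) \<and> (\<forall>j m. m \<le> 0 \<longrightarrow> u $ j $$ m = (h *v e k) $ j $$ m)" for k
    by (metis polynomial_part_vec)
  then obtain u where u: "\<And>k j. is_polynomial (u k $ j)"
      "\<And>k j m. m \<le> 0 \<Longrightarrow> u k $ j $$ m = (h *v e k) $ j $$ m"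
    by metis
  define r where "r k = e k - g *v u k" for k
  have r_eq: "r k = g *v (h *v e k - u k)" for k
    by (simp add: r_def matrix_vector_mult_diff_distrib matrix_vector_mul_assoc h)
  have r_low: "r k $ j $$ m = 0" if "m < a + 1" for k j m
    unfolding r_eq using a u(2) that by (intro matrix_vector_mult_nth_below[of a _ _ 1]) auto
  \<comment> \<open>The coefficients of \<open>r k\<close> that decide in which coset of the box it lies. Those below \<open>a + 1\<close>
    vanish, so only finitely many matter; the default \<open>0\<close> elsewhere makes the range of \<open>c\<close> finite.\<close>
  define c where "c k = (\<lambda>(j, m). if a + 1 \<le> m \<and> m < n j then r k $ j $$ m else 0)" for k
  let ?S = "SIGMA j:UNIV. {a + 1..<n j}"
  have "finite (range c)"
  proof (rule finite_subset)
    show "range c \<subseteq> {f. \<forall>x. (x \<in> ?S \<longrightarrow> f x \<in> UNIV) \<and> (x \<notin> ?S \<longrightarrow> f x = 0)}"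
      by (auto simp: c_def)
    show "finite {f. \<forall>x. (x \<in> ?S \<longrightarrow> f x \<in> (UNIV :: 'a set)) \<and> (x \<notin> ?S \<longrightarrow> f x = 0)}"
      by (intro finite_set_of_finite_funs) auto
  qed
  then have "\<not> inj c"
    using finite_imageD[of c UNIV] infinite_UNIV_nat by blast
  then obtain k l where kl: "k < l" "c k = c l"
    unfolding inj_on_def by (metis linorder_neqE_nat)
  have close: "r k $ j $$ m = r l $ j $$ m" if "m < n j" for j m
    using that r_low[of m] fun_cong[OF kl(2), of "(j, m)"] by (cases "m < a + 1") (auto simp: c_def)
  define w where "w = g *v (u k - u l)"
  have w: "w = e k - e l - (r k - r l)"
    by (simp add: w_def r_def matrix_vector_mult_diff_distrib)
  have "w \<in> lattice_of g"
    unfolding lattice_of_def w_def using u(1) by (auto intro!: exI[of _ "u k - u l"] is_polynomial_diff)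
  moreover have "w $ i $$ (n i - 1 - int l) \<noteq> 0"
    using kl(1) close[of "n i - 1 - int l" i] by (simp add: w e_def axis_def)
  then have "w \<noteq> 0" by auto
  moreover have "w \<in> coset_box (n(i := n i - 1 - int l)) 0"
  proof -
    have "w $ j $$ m = 0" if m: "m < (n(i := n i - 1 - int l)) j" for j m
    proof (cases "j = i")
      case True
      then show ?thesis
        using m kl(1) close[of m i] by (simp add: w e_def axis_def)
    next
      case False
      then show ?thesis
        using m close[of m j] by (simp add: w e_def axis_def)
    qed
    then show ?thesis
      by (simp add: coset_box_def)
  qed
  ultimately show thesis
    using that[of "n i - 1 - int l"] unfolding admissible_cutoff_iff by blast
qed

definition maximal_cutoff :: "'a::{field, finite} fls ^ 'n ^ 'n \<Rightarrow> ('n \<Rightarrow> int) \<Rightarrow> bool" where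
  "maximal_cutoff g n \<longleftrightarrow> admissible_cutoff g n \<and> (\<forall>i. \<not> admissible_cutoff g (n(i := n i - 1)))"

text \<open>Below \<open>n\<close>, each cutoff of an admissible box is bounded from below, since otherwise the box
  would contain one that is too long in a single direction. So an admissible cutoff below \<open>n\<close> with
  the least sum exists, and it is maximal.\<close>

lemma maximal_cutoff_below:
  fixes g :: "'a::{field, finite} fls ^ 'n ^ 'n"
  assumes g: "invertible g" and n: "admissible_cutoff g n"
  obtains m where "maximal_cutoff g m" "\<And>i. m i \<le> n i"
proof -
  have "\<forall>i. \<exists>l. \<not> admissible_cutoff g (n(i := l))"
    using long_box_not_admissible[OF g] by blast
  from choice[OF this] obtain l where l: "\<forall>i. \<not> admissible_cutoff g (n(i := l i))" ..
  define A where "A = {m. admissible_cutoff g m \<and> (\<forall>i. m i \<le> n i)}"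
  have low: "l i \<le> m i" if "m \<in> A" for m i
  proof (rule ccontr)
    assume "\<not> l i \<le> m i"
    then have "admissible_cutoff g (n(i := l i))"
      using that by (rule_tac admissible_cutoff_mono[of g m]) (auto simp: A_def)
    with l show False by blast
  qed
  have "n \<in> A"
    using n by (simp add: A_def)
  then obtain m where m: "m \<in> A" "\<And>m'. m' \<in> A \<Longrightarrow>
      nat (\<Sum>i\<in>UNIV. m i - l i) \<le> nat (\<Sum>i\<in>UNIV. m' i - l i)"
    using ex_has_least_nat[of "\<lambda>m. m \<in> A" n "\<lambda>m. nat (\<Sum>i\<in>UNIV. m i - l i)"] by blast
  have "\<not> admissible_cutoff g (m(i := m i - 1))" for i
  proof
    let ?m = "m(i := m i - 1)"
    assume "admissible_cutoff g ?m"
    then have A: "?m \<in> A"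
      using m(1) by (auto simp: A_def intro: order_trans[of _ "m i"])
    have "(\<Sum>j\<in>UNIV. ?m j - l j) < (\<Sum>j\<in>UNIV. m j - l j)"
      by (intro sum_strict_mono_ex1) auto
    moreover have "0 \<le> (\<Sum>j\<in>UNIV. ?m j - l j)"
      using low[OF A] by (intro sum_nonneg) auto
    ultimately show False
      using m(2)[OF A] by linarith
  qed
  then show thesis
    using m(1) by (intro that[of m]) (auto simp: A_def maximal_cutoff_def)
qed

text \<open>The columns \<open>v i\<close> of \<open>V = g ** P\<close> witness maximality. The dominant diagonal gives the absolute
  value of \<open>det V\<close>. Since the columns also generate the lattice, \<open>g = V ** B\<close> with \<open>B\<close> polynomial, so
  \<open>det P\<close> is a unit among polynomials and \<open>det V\<close> has the absolute value of \<open>det g\<close>.\<close>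

lemma maximal_cutoff_sum:
  fixes g :: "'a::{field, finite} fls ^ 'n ^ 'n"
  assumes g: "invertible g" "fls_abs (det g) = 1" and n: "maximal_cutoff g n"
  shows "(\<Sum>i\<in>UNIV. n i) = int CARD('n)"
proof -
  have adm: "v = 0" if "v \<in> lattice_of g" "v \<in> coset_box n 0" for v
    using that n unfolding maximal_cutoff_def admissible_cutoff_iff by blast
  have "\<exists>v. v \<in> lattice_of g \<and> v \<in> coset_box (n(i := n i - 1)) 0 \<and> v \<noteq> 0" for i
    using n unfolding maximal_cutoff_def admissible_cutoff_iff by blast
  then obtain v where v: "\<And>i. v i \<in> lattice_of g" "\<And>i. v i \<in> coset_box (n(i := n i - 1)) 0" "\<And>i. v i \<noteq> 0"
    by metis
  then have "\<forall>i. \<exists>u. v i = g *v u \<and> (\<forall>j. is_polynomial (u $ j))"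
    by (auto simp: lattice_of_def)
  then obtain u where u: "\<And>i. v i = g *v u i" "\<And>i j. is_polynomial (u i $ j)"
    by metis
  define V where "V = (\<chi> i j. v j $ i)"
  define P where "P = (\<chi> i j. u j $ i)"
  have V_eq: "V = g ** P"
    by (simp add: V_def P_def vec_eq_iff matrix_matrix_mult_def u(1) matrix_vector_mult_def)
  have vlow: "v i $ j $$ m = 0" if "m < (n(i := n i - 1)) j" for i j m
    using v(2)[of i] that unfolding coset_box_def by (auto simp del: fun_upd_apply)
  have vdiag: "v i $ i $$ (n i - 1) \<noteq> 0" for i
  proof
    assume *: "v i $ i $$ (n i - 1) = 0"
    have "v i $ j $$ m = 0" if "m < n j" for j m
      using that vlow[of m i j] * by (cases "j = i"; cases "m = n i - 1") auto
    then have "v i \<in> coset_box n 0"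
      by (simp add: coset_box_def)
    with v adm show False by blast
  qed
  have Vdet: "det V \<noteq> 0" "fls_subdegree (det V) = (\<Sum>i\<in>UNIV. n i - 1)"
  proof -
    have 1: "\<forall>m < n j. transpose V $ i $ j $$ m = 0" if "i \<noteq> j" for i j
      using vlow[of _ i j] that by (simp add: V_def transpose_def)
    have 2: "transpose V $ i $ i \<noteq> 0" for i
      using vdiag[of i] by (auto simp: V_def transpose_def)
    have 3: "fls_subdegree (transpose V $ i $ i) = n i - 1" for i
      using vdiag[of i] vlow[of _ i i] by (intro fls_subdegree_eqI) (simp_all add: V_def transpose_def)
    show "det V \<noteq> 0" "fls_subdegree (det V) = (\<Sum>i\<in>UNIV. n i - 1)"
      using det_subdegree_dominant_diagonal[of n "transpose V", OF 1 2 3] by simp_all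
  qed
  obtain W where W: "V ** W = mat 1"
    using Vdet(1) unfolding invertible_det_nz[symmetric] invertible_def by blast
  have generate: "\<exists>q. (\<forall>i. is_polynomial (q $ i)) \<and> w = V *v q" if w: "w \<in> lattice_of g" for w
  proof -
    obtain q where q: "\<And>i. is_polynomial (q $ i)" "\<And>i m. m \<le> 0 \<Longrightarrow> q $ i $$ m = (W *v w) $ i $$ m"
      by (rule polynomial_part_vec[of "W *v w"], rule that)
    \<comment> \<open>The entries of \<open>d\<close> have absolute value less than \<open>1\<close>. This compensates for the diagonal of \<open>V\<close>,
      which starts one index before the cutoff.\<close>
    define d where "d = W *v w - q"
    have d: "w - V *v q = V *v d"
      by (simp add: d_def matrix_vector_mult_diff_distrib matrix_vector_mul_assoc W)
    have "P *v q \<in> {x. \<forall>i. is_polynomial (x $ i)}"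
      using u(2) q(1) by (auto simp: matrix_vector_mult_def P_def intro!: is_polynomial_sum is_polynomial_mult)
    then have "V *v q \<in> lattice_of g"
      by (auto simp: lattice_of_def V_eq matrix_vector_mul_assoc[symmetric])
    then have "w - V *v q \<in> lattice_of g"
      by (intro lattice_of_diff w)
    moreover have "w - V *v q \<in> coset_box n 0"
    proof -
      have "(V *v d) $ j $$ m = 0" if "m < n j" for j m
      proof (rule matrix_vector_mult_nth_below[of "n j - 1" _ _ 1])
        show "\<forall>m < n j - 1. V $ j $ i $$ m = 0" for i
          by (auto simp: V_def intro!: vlow)
        show "\<forall>m < 1. d $ i $$ m = 0" for i
          using q(2) by (simp add: d_def)
      qed (use that in simp)
      then show ?thesis
        by (simp add: d coset_box_def)
    qed
    ultimately have "w = V *v q"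
      using adm[of "w - V *v q"] by simp
    with q(1) show ?thesis by blast
  qed
  have "g *v axis j 1 \<in> lattice_of g" for j
    unfolding lattice_of_def
    by (auto intro!: exI[of _ "axis j 1"] simp: axis_def is_polynomial_1 is_polynomial_iff[of 0])
  then have "\<forall>j. \<exists>q. (\<forall>i. is_polynomial (q $ i)) \<and> g *v axis j 1 = V *v q"
    by (intro allI generate)
  then obtain Q where Q: "\<And>j i. is_polynomial (Q j $ i)" "\<And>j. g *v axis j 1 = V *v Q j"
    by metis
  define B where "B = (\<chi> i j. Q j $ i)"
  have "g = V ** B"
  proof -
    have "g $ i $ j = (V ** B) $ i $ j" for i j
      using arg_cong[OF Q(2)[of j], of "\<lambda>x. x $ i"]
      by (simp add: matrix_vector_mult_def matrix_matrix_mult_def B_def axis_def if_distrib[of "\<lambda>x. _ * x"] cong: if_cong)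
    then show ?thesis
      by (simp add: vec_eq_iff)
  qed
  then have "det g = det g * (det P * det B)"
    using V_eq by (metis det_mul mult.assoc)
  moreover have g0: "det g \<noteq> 0"
    using g(1) by (simp add: invertible_det_nz)
  ultimately have PB: "det P * det B = 1"
    by simp
  then have nz: "det P \<noteq> 0" "det B \<noteq> 0"
    by auto
  have "fls_subdegree (det P) + fls_subdegree (det B) = 0"
    using arg_cong[OF PB, of fls_subdegree] nz by simp
  moreover have "fls_subdegree (det P) \<le> 0" "fls_subdegree (det B) \<le> 0"
    using nz u(2) Q(1) by (auto intro!: is_polynomial_subdegree_le is_polynomial_det simp: P_def B_def)
  ultimately have "fls_subdegree (det P) = 0"
    by simp
  moreover have "fls_subdegree (det g) = 0"
  proof -
    have "real CARD('a) powr real_of_int (- fls_subdegree (det g)) = 1"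
      using g(2) g0 one_less_card[where 'a = 'a] by (simp add: fls_abs_def powr_real_of_int' del: of_int_minus)
    then show ?thesis
      using one_less_card[where 'a = 'a] by simp
  qed
  ultimately have "fls_subdegree (det V) = 0"
    using V_eq g0 nz by (simp add: det_mul)
  with Vdet(2) show ?thesis
    by (simp add: sum_subtractf)
qed

section \<open>The Mordell function\<close>

lemma mordell_lattice_of:
  fixes g :: "'a::{field, finite} fls ^ 'n ^ 'n"
  assumes g: "invertible g" "fls_abs (det g) = 1"
  shows "mordell (lattice_of g) = ennreal (real CARD('a) powi (- int CARD('n)))"
proof -
  have q: "1 \<le> real CARD('a)"
    using one_less_card[where 'a = 'a] by simp
  have "mordell (lattice_of g) = Sup {emeasure vol (coset_box n (0 :: 'a fls ^ 'n)) | n. admissible_cutoff g n}"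
  proof -
    have "{emeasure vol B | B :: ('a fls ^ 'n) set. is_box B \<and> admissible (lattice_of g) B}
        = {emeasure vol (coset_box n (0 :: 'a fls ^ 'n)) | n. admissible_cutoff g n}"
      unfolding is_box_iff admissible_def admissible_cutoff_def by (intro Collect_cong) metis
    then show ?thesis
      unfolding mordell_def by (rule arg_cong)
  qed
  also have "\<dots> = ennreal (real CARD('a) powi (- int CARD('n)))"
  proof (rule antisym)
    show "Sup {emeasure vol (coset_box n (0 :: 'a fls ^ 'n)) | n. admissible_cutoff g n}
        \<le> ennreal (real CARD('a) powi (- int CARD('n)))"
    proof (rule Sup_least, clarify)
      fix n assume "admissible_cutoff g n"
      then obtain m where m: "maximal_cutoff g m" "\<And>i. m i \<le> n i"
        using maximal_cutoff_below[OF g(1)] by blast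
      have "int CARD('n) \<le> (\<Sum>i\<in>UNIV. n i)"
        unfolding maximal_cutoff_sum[OF g m(1), symmetric] by (intro sum_mono m)
      then show "emeasure vol (coset_box n (0 :: 'a fls ^ 'n)) \<le> ennreal (real CARD('a) powi (- int CARD('n)))"
        using q by (auto simp: emeasure_vol_coset_box intro!: ennreal_leI power_int_increasing)
    qed
    obtain n where "admissible_cutoff g n"
      by (rule admissible_cutoff_exists[OF g(1)])
    then obtain m where m: "maximal_cutoff g m"
      using maximal_cutoff_below[OF g(1)] by blast
    then have "admissible_cutoff g m"
      by (simp add: maximal_cutoff_def)
    moreover have "emeasure vol (coset_box m (0 :: 'a fls ^ 'n)) = ennreal (real CARD('a) powi (- int CARD('n)))"
      by (simp add: emeasure_vol_coset_box maximal_cutoff_sum[OF g m])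
    ultimately show "ennreal (real CARD('a) powi (- int CARD('n)))
        \<le> Sup {emeasure vol (coset_box n (0 :: 'a fls ^ 'n)) | n. admissible_cutoff g n}"
      by (intro Sup_upper) (auto intro: exI[of _ m])
  qed
  finally show ?thesis .
qed

theorem theorem1p37:
  assumes "CARD('n::finite) \<ge> 2"
  shows "gruber_mordell_spectrum TYPE('a::{field, finite}) TYPE('n)
           = {ennreal (real CARD('a) powi (- int CARD('n)))} \<and>
         (\<forall>\<Lambda> \<in> (unimodular_lattices :: (('a fls) ^ 'n) set set).
           mordell \<Lambda> = ennreal (real CARD('a) powi (- int CARD('n))))"
proof -
  have all: "\<forall>\<Lambda> \<in> (unimodular_lattices :: (('a fls) ^ 'n) set set).
      mordell \<Lambda> = ennreal (real CARD('a) powi (- int CARD('n)))"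
    unfolding unimodular_lattices_eq using mordell_lattice_of by blast
  have "lattice_of (mat 1) \<in> (unimodular_lattices :: (('a fls) ^ 'n) set set)"
    unfolding unimodular_lattices_eq
    by (auto intro!: exI[of _ "mat 1"] simp: fls_abs_def invertible_det_nz)
  then have "{mordell \<Lambda> | \<Lambda> :: ('a fls ^ 'n) set. \<Lambda> \<in> unimodular_lattices}
      = {ennreal (real CARD('a) powi (- int CARD('n)))}"
    using all by (intro equalityI subsetI) force+
  with all show ?thesis
    unfolding gruber_mordell_spectrum_def by blast
qed

end
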